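(* Let $n\ge 2$, $V=\{1,\dots,n\}$, $r\in V$. Urn-Tree: run the following color-assignment process on an urn of labelled balls $b_1,\dots,b_n$ (ball $b_j$ corresponds to vertex $j$) with colors $c_0,\dots,c_{n-1}$, $A$ denoting the set of uncolored balls: paint $b_r$ with $c_0$, set $i=1$, paint a uniformly chosen ball of $A$ with $c_1$; then repeatedly, while $A\neq\varnothing$, draw a ball uniformly from all $n$ balls: if uncolored, paint it $c_i$; if colored, set $i\leftarrow i+1$ and paint a uniformly chosen ball of $A$ with $c_i$. Let $C_i$ be the sequence (in order of painting) of balls painted $c_i$. Build a tree: start with $V_T=\{r\}$, $E_T=\varnothing$; for $i=1,2,\dots$ while $C_i\ne\varnothing$: let $P$ be the path graph through the vertices of $C_i$ in order, choose $u$ uniformly from the current $V_T$, let $v$ be the first element of $C_i$, and add $V(P)$ to $V_T$ and $E(P)\cup\{\{u,v\}\}$ to $E_T$. Let $T^U_i$ be the tree right after the $i$-th path has been attached (if $C_i=\varnothing$, $T^U_i$ is the final tree). Aldous-Broder: let $G$ be the complete graph with self-loops on $V$ (a simple random walk moves at each step to a uniformly chosen vertex of $V$, possibly staying put), let $(X_t)_{t\ge0}$ be a simple random walk on $G$ with $X_0=r$, $V_t=\{X_0,\dots,X_t\}$, $\eta$ the cover time, $\sigma^{\rm in}_0=0$, and for $i\ge1$, $\sigma^{\rm out}_i=\inf\{t>\sigma^{\rm in}_{i-1}: X_t\notin V_{t-1}\}\wedge\eta$, $\sigma^{\rm in}_i=\inf\{t>\sigma^{\rm out}_i: X_t\in V_{t-1}\}\wedge\eta$.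 Let $T^{AB}_s$ be the tree with vertex set $V_s$ and edges $\{X_t,X_{t+1}\}$ for $t<s$ with $X_{t+1}\ne X_k$ for all $k\le t$. Then $T^U_i$ and $T^{AB}_{\sigma^{\rm in}_i}$ have the same distribution (as random labelled trees) for all $i=1,\dots,n-1$. *)

theory Defs
  imports "HOL-Probability.Probability"
begin

section \<open>Labelled trees\<close>

text \<open>A labelled graph is a pair of a vertex set and a set of edges, each edge
  being the set of its two endpoints.\<close>

type_synonym 'v graph = "'v set \<times> 'v set set"

definition path_edges :: "'v list \<Rightarrow> 'v set set" where
  "path_edges vs = {{vs ! k, vs ! Suc k} | k. Suc k < length vs}"

section \<open>The urn process and its tree\<close>

text \<open>A coloring maps each color index to the list of balls painted with that color,
  in order of painting.\<close>

type_synonym coloring = "nat \<Rightarrow> nat list"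

definition paint :: "nat \<Rightarrow> nat \<Rightarrow> coloring \<Rightarrow> coloring" where
  "paint j c C = C(c := C c @ [j])"

definition uncolored :: "nat \<Rightarrow> coloring \<Rightarrow> nat set" where
  "uncolored n C = {1..n} - (\<Union>c. set (C c))"

lemma finite_uncolored [simp]: "finite (uncolored n C)"
  by (simp add: uncolored_def)

lemma card_uncolored_paint:
  assumes "j \<in> uncolored n C"
  shows "card (uncolored n (paint j c C)) < card (uncolored n C)"
proof (rule psubset_card_mono)
  have "uncolored n (paint j c C) = uncolored n C - {j}"
    by (auto simp: uncolored_def paint_def split: if_splits)
  with assms show "uncolored n (paint j c C) \<subset> uncolored n C" by auto
qed simp

text \<open>The loop with current color index \<open>i\<close>.\<close>

function urn_loop :: "nat \<Rightarrow> nat \<Rightarrow> coloring \<Rightarrow> coloring pmf" where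
  "urn_loop n i C =
     (if uncolored n C = {} then return_pmf C
      else bind_pmf (pmf_of_set {1..n}) (\<lambda>j.
        if j \<in> uncolored n C then urn_loop n i (paint j i C)
        else bind_pmf (pmf_of_set (uncolored n C)) (\<lambda>l.
          urn_loop n (Suc i) (paint l (Suc i) C))))"
  by pat_completeness auto
termination
  by (relation "Wellfounded.measure (\<lambda>(n, i, C). card (uncolored n C))")
     (auto simp: card_uncolored_paint)

declare urn_loop.simps [simp del]

definition urn_coloring :: "nat \<Rightarrow> nat \<Rightarrow> coloring pmf" where
  "urn_coloring n r =
     (let C0 = paint r 0 (\<lambda>_. [])
      in bind_pmf (pmf_of_set (uncolored n C0)) (\<lambda>j. urn_loop n 1 (paint j 1 C0)))"

text \<open>The tree after the first \<open>i\<close> attachments. The process uses colors consecutively,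
  so once some \<open>C (Suc i)\<close> is empty all later ones are empty as well and the tree no
  longer changes.\<close>

primrec attach_paths :: "nat \<Rightarrow> coloring \<Rightarrow> nat \<Rightarrow> nat graph pmf" where
  "attach_paths r C 0 = return_pmf ({r}, {})"
| "attach_paths r C (Suc i) =
     bind_pmf (attach_paths r C i) (\<lambda>(VT, ET).
       if C (Suc i) = [] then return_pmf (VT, ET)
       else bind_pmf (pmf_of_set VT) (\<lambda>u.
         return_pmf (VT \<union> set (C (Suc i)),
                     ET \<union> path_edges (C (Suc i)) \<union> {{u, hd (C (Suc i))}})))"

definition urn_tree :: "nat \<Rightarrow> nat \<Rightarrow> nat \<Rightarrow> nat graph pmf" where
  "urn_tree n r i = bind_pmf (urn_coloring n r) (\<lambda>C. attach_paths r C i)"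

section \<open>Simple random walk and the Aldous--Broder tree\<close>

text \<open>Simple random walk on the graph with vertex set \<open>V\<close> and symmetric adjacency
  relation \<open>E\<close>, in which a self-loop at \<open>v\<close> is the pair \<open>(v, v)\<close> and contributes
  one to the degree.\<close>

locale simple_random_walk = prob_space M
  for M :: "'a measure" and V :: "'v set" and E :: "('v \<times> 'v) set" and r :: 'v
    and X :: "nat \<Rightarrow> 'a \<Rightarrow> 'v" +
  assumes walk_measurable: "\<And>t. X t \<in> measurable M (count_space V)"
    and walk_start: "AE \<omega> in M. X 0 \<omega> = r"
    and walk_step: "\<And>t x y. \<P>(\<omega> in M. \<forall>k\<le>t. X k \<omega> = x k) \<noteq> 0 \<Longrightarrow>
      \<P>(\<omega> in M. X (Suc t) \<omega> = y \<bar> \<forall>k\<le>t. X k \<omega> = x k)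
        = (if (x t, y) \<in> E then 1 / real (card (E `` {x t})) else 0)"

definition complete_graph_with_loops :: "'v set \<Rightarrow> ('v \<times> 'v) set" where
  "complete_graph_with_loops V = V \<times> V"

text \<open>The following are functions of a single trajectory \<open>x\<close>. Times are extended naturals,
  so that the infimum of the empty set is \<open>\<infinity>\<close>.\<close>

definition visited :: "(nat \<Rightarrow> 'v) \<Rightarrow> nat \<Rightarrow> 'v set" where
  "visited x t = x ` {..t}"

definition cover_time :: "'v set \<Rightarrow> (nat \<Rightarrow> 'v) \<Rightarrow> enat" where
  "cover_time V x = Inf {enat t | t. visited x t = V}"

definition next_out :: "'v set \<Rightarrow> (nat \<Rightarrow> 'v) \<Rightarrow> enat \<Rightarrow> enat" where
  "next_out V x s =
     min (Inf {enat t | t. enat t > s \<and> x t \<notin> visited x (t - 1)}) (cover_time V x)"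

definition next_in :: "'v set \<Rightarrow> (nat \<Rightarrow> 'v) \<Rightarrow> enat \<Rightarrow> enat" where
  "next_in V x s =
     min (Inf {enat t | t. enat t > s \<and> x t \<in> visited x (t - 1)}) (cover_time V x)"

primrec sigma_in :: "'v set \<Rightarrow> (nat \<Rightarrow> 'v) \<Rightarrow> nat \<Rightarrow> enat" where
  "sigma_in V x 0 = 0"
| "sigma_in V x (Suc i) = next_in V x (next_out V x (sigma_in V x i))"

definition AB_tree :: "(nat \<Rightarrow> 'v) \<Rightarrow> enat \<Rightarrow> 'v graph" where
  "AB_tree x s =
     ({x t | t. enat t \<le> s},
      {{x t, x (Suc t)} | t. enat t < s \<and> (\<forall>k\<le>t. x (Suc t) \<noteq> x k)})"

end

theory Submission
  imports Defs
begin

text \<open>The idea is a martingale argument. The state of the walk at time \<open>t\<close> consists of the tree built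
  so far, the current vertex, the number of paths still to be started, and whether the walk is
  inside a path or wandering among visited vertices. To each state we assign the law of the
  final tree obtained by letting the urn finish the construction. This law is harmonic for a uniform
  step of the walk, because a wandering walk leaves the visited set from a uniform visited vertex
  to a uniform new one, exactly as the urn attaches a path. At time 0 it is the law of the urn
  tree; once the walk has covered the graph it is the point mass at the Aldous--Broder
  tree. The probability of not having covered by time \<open>t\<close> tends to 0.\<close>

section \<open>The urn tree as a potential of the walk\<close>

text \<open>A uniform draw from \<open>U\<close>, conditioned on landing in \<open>S\<close>, is
  uniform on \<open>S\<close>. So on that event the drawn value may be replaced by a fresh uniform
  element of \<open>S\<close>.\<close>

lemma bind_pmf_of_set_resample:
  assumes "finite U" "S \<subseteq> U" "S \<noteq> {}"
  shows "bind_pmf (pmf_of_set U) (\<lambda>y. if y \<in> S then Q y else A y) =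
    bind_pmf (pmf_of_set U) (\<lambda>y. if y \<in> S then bind_pmf (pmf_of_set S) Q else A y)"
proof (rule pmf_eqI)
  fix x
  have S: "finite S" and U: "U \<noteq> {}"
    using assms finite_subset by auto
  \<comment> \<open>\<open>R\<close> is left free so that both sides can be split: \<open>Q\<close>
    itself on the left, its constant average over \<open>S\<close> on the right.\<close>
  have *: "(\<Sum>y\<in>U. pmf (if y \<in> S then R y else A y) x) =
      (\<Sum>y\<in>U - S. pmf (A y) x) + (\<Sum>y\<in>S. pmf (R y) x)" for R
    using assms(1,2) by (subst sum.subset_diff[of S U]) auto
  show "pmf (bind_pmf (pmf_of_set U) (\<lambda>y. if y \<in> S then Q y else A y)) x =
    pmf (bind_pmf (pmf_of_set U) (\<lambda>y. if y \<in> S then bind_pmf (pmf_of_set S) Q else A y)) x"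
    using assms S U by (simp add: pmf_bind_pmf_of_set *)
qed

lemma bind_pmf_of_set_resample_Diff:
  assumes "finite U" "V \<subseteq> U" "V \<noteq> {}"
  shows "bind_pmf (pmf_of_set U) (\<lambda>y. if y \<in> U - V then A y else Q y) =
    bind_pmf (pmf_of_set U) (\<lambda>y. if y \<in> U - V then A y else bind_pmf (pmf_of_set V) Q)"
proof -
  have U: "U \<noteq> {}" using assms by auto
  have flip: "bind_pmf (pmf_of_set U) (\<lambda>y. if y \<in> U - V then A y else R y) =
      bind_pmf (pmf_of_set U) (\<lambda>y. if y \<in> V then R y else A y)" for R
    using assms U by (intro bind_pmf_cong) auto
  show ?thesis
    unfolding flip by (rule bind_pmf_of_set_resample[OF assms])
qed

lemma card_Diff_insert_less:
  "finite U \<Longrightarrow> j \<in> U \<Longrightarrow> j \<notin> V \<Longrightarrow> card (U - insert j V) < card (U - V)"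
  by (intro psubset_card_mono) auto

text \<open>The urn loop and the attachment of the paths run simultaneously: \<open>V\<close> and \<open>E\<close> form the tree so far,
  \<open>p\<close> is the end of the current path, and \<open>m\<close> more paths may be started. The \<open>infinite\<close> test
  only serves termination.\<close>

function branch_loop :: "'v set \<Rightarrow> nat \<Rightarrow> 'v set \<Rightarrow> 'v set set \<Rightarrow> 'v \<Rightarrow> 'v graph pmf" where
  "branch_loop U m V E p =
     (if infinite U \<or> U - V = {} then return_pmf (V, E)
      else bind_pmf (pmf_of_set U) (\<lambda>j.
        if j \<in> U - V then branch_loop U m (insert j V) (insert {p, j} E) j
        else case m of
          0 \<Rightarrow> return_pmf (V, E)
        | Suc k \<Rightarrow> bind_pmf (pmf_of_set V) (\<lambda>u. bind_pmf (pmf_of_set (U - V)) (\<lambda>l.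
            branch_loop U k (insert l V) (insert {u, l} E) l))))"
  by pat_completeness auto
termination
  by (relation "Wellfounded.measure (\<lambda>(U, m, V, E, p). card (U - V))")
     (auto simp: card_Diff_insert_less simp del: card_Diff_insert)

declare branch_loop.simps [simp del]

text \<open>The new-color branch of \<open>branch_loop\<close>, given a name because a wandering
  walk turns out to have the same law.\<close>

definition sprout :: "'v set \<Rightarrow> nat \<Rightarrow> 'v set \<Rightarrow> 'v set set \<Rightarrow> 'v graph pmf" where
  "sprout U k V E = bind_pmf (pmf_of_set V) (\<lambda>u. bind_pmf (pmf_of_set (U - V)) (\<lambda>l.
     branch_loop U k (insert l V) (insert {u, l} E) l))"

lemma branch_loop_rec:
  assumes "finite U" "U - V \<noteq> {}"
  shows "branch_loop U m V E p = bind_pmf (pmf_of_set U) (\<lambda>j.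
        if j \<in> U - V then branch_loop U m (insert j V) (insert {p, j} E) j
        else case m of 0 \<Rightarrow> return_pmf (V, E) | Suc k \<Rightarrow> sprout U k V E)"
  using assms
  by (subst branch_loop.simps) (auto simp: sprout_def intro!: bind_pmf_cong split: nat.split)

lemma branch_loop_covered:
  "U - V = {} \<Longrightarrow> branch_loop U m V E p = return_pmf (V, E)"
  by (subst branch_loop.simps) simp

text \<open>The law of the final tree for a walk standing at the visited vertex \<open>p\<close> between two paths:
  if the next step stays inside \<open>V\<close>, then \<open>p\<close> is forgotten.\<close>

definition wander :: "'v set \<Rightarrow> nat \<Rightarrow> 'v set \<Rightarrow> 'v set set \<Rightarrow> 'v \<Rightarrow> 'v graph pmf" where
  "wander U k V E p = bind_pmf (pmf_of_set U) (\<lambda>y.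
     if y \<in> U - V then branch_loop U k (insert y V) (insert {p, y} E) y else sprout U k V E)"

text \<open>Let \<open>u\<close> be uniform on \<open>V\<close> and \<open>y\<close> uniform on
  \<open>U\<close>, independently. If \<open>y\<close> falls outside \<open>V\<close>, the pair is
  exactly the attachment vertex and the new vertex of \<open>sprout\<close>; otherwise the law is
  \<open>sprout\<close> by definition. Hence the number of steps spent wandering has no
  influence.\<close>

lemma bind_wander:
  assumes "finite U" "V \<subset> U" "V \<noteq> {}"
  shows "bind_pmf (pmf_of_set V) (wander U k V E) = sprout U k V E"
proof -
  define B where "B u y = branch_loop U k (insert y V) (insert {u, y} E) y" for u y
  have "bind_pmf (pmf_of_set V) (wander U k V E) =
      bind_pmf (pmf_of_set U) (\<lambda>y. bind_pmf (pmf_of_set V) (\<lambda>u.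
        if y \<in> U - V then B u y else sprout U k V E))"
    unfolding wander_def B_def by (rule bind_commute_pmf)
  also have "\<dots> = bind_pmf (pmf_of_set U) (\<lambda>y.
      if y \<in> U - V then bind_pmf (pmf_of_set V) (\<lambda>u. B u y) else sprout U k V E)"
    by (intro bind_pmf_cong) auto
  also have "\<dots> = bind_pmf (pmf_of_set U) (\<lambda>y. if y \<in> U - V
      then bind_pmf (pmf_of_set (U - V)) (\<lambda>y. bind_pmf (pmf_of_set V) (\<lambda>u. B u y))
      else sprout U k V E)"
    using assms by (intro bind_pmf_of_set_resample) auto
  also have "bind_pmf (pmf_of_set (U - V)) (\<lambda>y. bind_pmf (pmf_of_set V) (\<lambda>u. B u y)) =
      sprout U k V E"
    unfolding sprout_def B_def by (rule bind_commute_pmf)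
  \<comment> \<open>Both branches are now \<open>sprout\<close>, so the draw from \<open>U\<close>
    no longer matters.\<close>
  finally show ?thesis
    by simp
qed

text \<open>In \<open>(b, m, V, E, p)\<close> the flag \<open>b\<close> tells whether the walk is inside a path, and \<open>m\<close> counts
  the paths still to be started.\<close>

type_synonym 'v walk_state = "bool \<times> nat \<times> 'v set \<times> 'v set set \<times> 'v"

text \<open>The two alternatives mirror the definition of the stopping times: the cover time has
  been reached, or the last permitted path has ended with a return to \<open>V\<close>.\<close>

definition stopped :: "'v set \<Rightarrow> 'v walk_state \<Rightarrow> bool" where
  "stopped U = (\<lambda>(b, m, V, E, p). U - V = {} \<or> \<not> b \<and> m = 0)"

text \<open>Stopped states are absorbing, so a run of fixed length freezes the tree at the stopping
  time. The subtraction \<open>m - 1\<close> is reached only from an unstopped wandering state,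
  where \<open>m\<close> is positive.\<close>

definition walk_step :: "'v set \<Rightarrow> 'v \<Rightarrow> 'v walk_state \<Rightarrow> 'v walk_state" where
  "walk_step U y = (\<lambda>(b, m, V, E, p).
     if stopped U (b, m, V, E, p) then (b, m, V, E, p)
     else if y \<in> U - V then (True, if b then m else m - 1, insert y V, insert {p, y} E, y)
     else (False, m, V, E, y))"

lemma walk_step_stopped: "stopped U s \<Longrightarrow> walk_step U y s = s"
  by (cases s) (simp add: walk_step_def)

definition state_graph :: "'v walk_state \<Rightarrow> 'v graph" where
  "state_graph = (\<lambda>(b, m, V, E, p). (V, E))"

text \<open>The potential of the argument. \<open>wander\<close> receives \<open>m - 1\<close>
  because the path about to begin is itself one of the \<open>m\<close> still to be started.\<close>

definition final_tree :: "'v set \<Rightarrow> 'v walk_state \<Rightarrow> 'v graph pmf" where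
  "final_tree U = (\<lambda>(b, m, V, E, p).
     if stopped U (b, m, V, E, p) then return_pmf (V, E)
     else if b then branch_loop U m V E p else wander U (m - 1) V E p)"

lemma final_tree_stopped: "stopped U s \<Longrightarrow> final_tree U s = return_pmf (state_graph s)"
  by (auto simp: final_tree_def state_graph_def split: prod.splits)

definition valid_state :: "'v set \<Rightarrow> 'v walk_state \<Rightarrow> bool" where
  "valid_state U = (\<lambda>(b, m, V, E, p). V \<subseteq> U \<and> V \<noteq> {})"

lemma valid_walk_step: "valid_state U s \<Longrightarrow> valid_state U (walk_step U y s)"
  by (auto simp: valid_state_def walk_step_def split: prod.splits)

text \<open>A step out of \<open>V\<close> reproduces the recursion of \<open>branch_loop\<close> or
  \<open>wander\<close> directly. A step that stays in \<open>V\<close> lands uniformly on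
  \<open>V\<close>, so the potential there can be averaged over \<open>V\<close>, and
  \<open>bind_wander\<close> turns the average into \<open>sprout\<close>.\<close>

lemma final_tree_harmonic:
  assumes U: "finite U" and valid: "valid_state U s"
  shows "bind_pmf (pmf_of_set U) (\<lambda>y. final_tree U (walk_step U y s)) = final_tree U s"
proof -
  obtain b m V E p where s: "s = (b, m, V, E, p)" by (cases s)
  show ?thesis
  proof (cases "stopped U s")
    case True
    then show ?thesis by (simp add: walk_step_stopped)
  next
    case False
    then have V: "V \<subset> U" "V \<noteq> {}" "U - V \<noteq> {}" and bm: "b \<or> 0 < m"
      using valid by (auto simp: s stopped_def valid_state_def)
    define k where "k = (if b then m else m - 1)"
    \<comment> \<open>If \<open>y\<close> is the last missing vertex, the new state is stopped, in
      agreement with \<open>branch_loop_covered\<close>.\<close>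
    have step: "final_tree U (walk_step U y s) =
        (if y \<in> U - V then branch_loop U k (insert y V) (insert {p, y} E) y
         else final_tree U (False, m, V, E, y))" for y
      using False by (auto simp: walk_step_def s k_def final_tree_def stopped_def branch_loop_covered)
    \<comment> \<open>For \<open>m = 0\<close> the return ends the last path, and the tree is
      final.\<close>
    have stay: "bind_pmf (pmf_of_set V) (\<lambda>y. final_tree U (False, m, V, E, y)) =
        (case m of 0 \<Rightarrow> return_pmf (V, E) | Suc k \<Rightarrow> sprout U k V E)"
      using V bind_wander[OF U V(1,2)]
      by (auto simp: final_tree_def stopped_def split: nat.split)
    have "bind_pmf (pmf_of_set U) (\<lambda>y. final_tree U (walk_step U y s)) =
      bind_pmf (pmf_of_set U) (\<lambda>y.
        if y \<in> U - V then branch_loop U k (insert y V) (insert {p, y} E) y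
        else case m of 0 \<Rightarrow> return_pmf (V, E) | Suc k \<Rightarrow> sprout U k V E)"
      unfolding step stay[symmetric]
      by (rule bind_pmf_of_set_resample_Diff) (use U V in auto)
    also have "\<dots> = final_tree U s"
    proof (cases b)
      case True
      then have "k = m" by (simp add: k_def)
      with True show ?thesis
        using False V U unfolding \<open>k = m\<close> by (simp add: s final_tree_def branch_loop_rec)
    next
      case b: False
      then obtain k' where m: "m = Suc k'"
        using bm by (cases m) auto
      then have "k = k'" using b by (simp add: k_def)
      with b show ?thesis
        using False V U unfolding \<open>k = k'\<close> m nat.case
        by (simp add: s final_tree_def m wander_def)
    qed
    finally show ?thesis .
  qed
qed

text \<open>Harmonicity iterated. \<open>foldr\<close> applies the head of the list last, so the
  head is the most recent step and the induction removes the steps from the latest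
  backwards.\<close>

lemma bind_replicate_pmf_final_tree:
  assumes "finite U" "valid_state U s"
  shows "bind_pmf (replicate_pmf t (pmf_of_set U)) (\<lambda>h. final_tree U (foldr (walk_step U) h s)) =
    final_tree U s"
proof (induction t)
  case 0
  show ?case by (simp add: bind_return_pmf)
next
  case (Suc t)
  have valid: "valid_state U (foldr (walk_step U) h s)" for h
    using assms(2) by (induction h) (auto intro: valid_walk_step)
  have "bind_pmf (replicate_pmf (Suc t) (pmf_of_set U))
      (\<lambda>h. final_tree U (foldr (walk_step U) h s)) =
    bind_pmf (pmf_of_set U) (\<lambda>y. bind_pmf (replicate_pmf t (pmf_of_set U))
      (\<lambda>h. final_tree U (walk_step U y (foldr (walk_step U) h s))))"
    by (simp add: bind_assoc_pmf bind_return_pmf)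
  \<comment> \<open>The newest step is moved innermost, where harmonicity absorbs it.\<close>
  also have "\<dots> = bind_pmf (replicate_pmf t (pmf_of_set U)) (\<lambda>h. bind_pmf (pmf_of_set U)
      (\<lambda>y. final_tree U (walk_step U y (foldr (walk_step U) h s))))"
    by (rule bind_commute_pmf)
  also have "\<dots> = final_tree U s"
    using Suc by (simp add: final_tree_harmonic[OF assms(1) valid])
  finally show ?case .
qed

definition start_state :: "nat \<Rightarrow> 'v \<Rightarrow> 'v walk_state" where
  "start_state i r = (False, i, {r}, {}, r)"

section \<open>Attaching the paths while the urn is running\<close>

lemma attach_paths_cong:
  "(\<And>k. 0 < k \<Longrightarrow> k \<le> i \<Longrightarrow> C k = D k) \<Longrightarrow> attach_paths r C i = attach_paths r D i"
proof (induction i)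
  case (Suc i)
  have "attach_paths r C i = attach_paths r D i" "C (Suc i) = D (Suc i)"
    using Suc by simp_all
  then show ?case by (simp only: attach_paths.simps)
qed simp

lemma attach_paths_stationary:
  assumes "c \<le> i" "\<And>k. c < k \<Longrightarrow> C k = []"
  shows "attach_paths r C i = attach_paths r C c"
  using assms
proof (induction i)
  case (Suc i)
  show ?case
  proof (cases "c = Suc i")
    case False
    then have "attach_paths r C i = attach_paths r C c" "C (Suc i) = []"
      using Suc by auto
    then show ?thesis
      by (simp add: case_prod_beta bind_return_pmf')
  qed simp
qed simp

text \<open>Only the attachment vertices are random; the vertex set is determined by the coloring.
  This later identifies unvisited vertices with uncolored balls.\<close>

lemma fst_attach_paths:
  "(V, E) \<in> set_pmf (attach_paths r C c) \<Longrightarrow> V = insert r (\<Union>k\<in>{1..c}. set (C k))"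
proof (induction c arbitrary: V E)
  case (Suc c)
  then obtain V' E' where V': "(V', E') \<in> set_pmf (attach_paths r C c)"
      and V: "V = V' \<union> set (C (Suc c))"
    by (auto split: if_splits)
  show ?case
    using Suc.IH[OF V'] V by (auto simp: atLeastAtMostSuc_conv)
qed auto

lemma path_edges_snoc:
  assumes "vs \<noteq> []"
  shows "path_edges (vs @ [v]) = insert {last vs, v} (path_edges vs)"
proof -
  let ?e = "\<lambda>xs k. {xs ! k, xs ! Suc k}" and ?K = "{k. Suc k < length vs}"
  have edges: "path_edges xs = ?e xs ` {k. Suc k < length xs}" for xs :: "'a list"
    by (auto simp: path_edges_def)
  have "{k. Suc k < length (vs @ [v])} = insert (length vs - 1) ?K"
    using assms by (cases vs) auto
  moreover have "?e (vs @ [v]) (length vs - 1) = {last vs, v}"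
    using assms by (simp add: nth_append last_conv_nth)
  moreover have "?e (vs @ [v]) ` ?K = ?e vs ` ?K"
    by (intro image_cong) (simp_all add: nth_append)
  ultimately show ?thesis
    by (simp only: edges image_insert)
qed

text \<open>The current path already has a first vertex, so its attachment edge is unaffected and
  the new ball merely prolongs it at its end.\<close>

lemma attach_paths_paint:
  assumes "0 < c" "C c \<noteq> []"
  shows "attach_paths r (paint j c C) c =
    map_pmf (\<lambda>(V, E). (insert j V, insert {last (C c), j} E)) (attach_paths r C c)"
proof -
  obtain k where c: "c = Suc k"
    using assms by (cases c) auto
  have "attach_paths r (paint j c C) k = attach_paths r C k"
    by (rule attach_paths_cong) (auto simp: paint_def c)
  then show ?thesis
    using assms(2)
    by (auto simp: c map_bind_pmf paint_def path_edges_snoc insert_commute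
        intro!: bind_pmf_cong)
qed

text \<open>A path of one vertex has no edges of its own; only the attachment edge is new.\<close>

lemma attach_paths_paint_Suc:
  assumes "C (Suc c) = []"
  shows "attach_paths r (paint l (Suc c) C) (Suc c) =
    bind_pmf (attach_paths r C c) (\<lambda>(V, E). bind_pmf (pmf_of_set V)
      (\<lambda>u. return_pmf (insert l V, insert {u, l} E)))"
proof -
  have "attach_paths r (paint l (Suc c) C) c = attach_paths r C c"
    by (rule attach_paths_cong) (auto simp: paint_def)
  then show ?thesis
    using assms by (auto simp: paint_def path_edges_def intro!: bind_pmf_cong)
qed

lemma uncolored_paint: "uncolored n (paint j c C) = uncolored n C - {j}"
  by (auto simp: uncolored_def paint_def split: if_splits)

lemma urn_loop_unchanged:
  "C' \<in> set_pmf (urn_loop n c C) \<Longrightarrow> k < c \<Longrightarrow> C' k = C k"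
proof (induction n c C rule: urn_loop.induct)
  case (1 n c C)
  show ?case
  proof (cases "uncolored n C = {}")
    case True
    then show ?thesis using 1(3) by (simp add: urn_loop.simps[of n c C])
  next
    case False
    then have n: "{1..n} \<noteq> {}" by (auto simp: uncolored_def)
    from 1(3)[unfolded urn_loop.simps[of n c C]] False consider
        j where "j \<in> uncolored n C" "C' \<in> set_pmf (urn_loop n c (paint j c C))"
      | l j where "j \<in> {1..n}" "j \<notin> uncolored n C" "l \<in> uncolored n C"
          "C' \<in> set_pmf (urn_loop n (Suc c) (paint l (Suc c) C))"
      using n by (auto split: if_splits) blast+
    then show ?thesis
    proof cases
      case 1
      have "j \<in> set_pmf (pmf_of_set {1..n})"
        using 1(1) n by (auto simp: uncolored_def)
      from "1.IH"(1)[OF False this 1] \<open>k < c\<close> show ?thesis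
        by (simp add: paint_def)
    next
      case 2
      have "j \<in> set_pmf (pmf_of_set {1..n})" "l \<in> set_pmf (pmf_of_set (uncolored n C))"
        using 2 n False by auto
      from "1.IH"(2)[OF False this(1) 2(2) this(2) 2(4)] \<open>k < c\<close> show ?thesis
        by (simp add: paint_def)
    qed
  qed
qed

lemma urn_loop_attach_paths_less:
  assumes "i < c"
  shows "bind_pmf (urn_loop n c C) (\<lambda>C'. attach_paths r C' i) = attach_paths r C i"
proof -
  have "bind_pmf (urn_loop n c C) (\<lambda>C'. attach_paths r C' i) =
      bind_pmf (urn_loop n c C) (\<lambda>_. attach_paths r C i)"
    using assms urn_loop_unchanged
    by (intro bind_pmf_cong refl attach_paths_cong) auto
  then show ?thesis by simp
qed

text \<open>The attachment vertex of a path depends only on the tree built before it, so it may be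
  drawn when the path begins instead of after the whole urn run. The induction follows the urn loop,
  with \<open>c\<close> the color in use and \<open>i - c\<close> the paths still allowed.\<close>

lemma urn_loop_attach_paths:
  assumes "0 < c" "c \<le> i" "C c \<noteq> []" "\<And>k. c < k \<Longrightarrow> C k = []" "C 0 = [r]"
  shows "bind_pmf (urn_loop n c C) (\<lambda>C'. attach_paths r C' i) =
    bind_pmf (attach_paths r C c) (\<lambda>(V, E). branch_loop {1..n} (i - c) V E (last (C c)))"
  using assms
proof (induction n c C rule: urn_loop.induct)
  case (1 n c C)
  let ?U = "{1..n}" and ?A = "uncolored n C" and ?T = "attach_paths r C c"
  have A: "?U - V = ?A" if VE: "(V, E) \<in> set_pmf ?T" for V E
  proof -
    have "V = insert r (\<Union>k\<in>{1..c}. set (C k))"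
      using fst_attach_paths[OF VE] .
    also have "\<dots> = (\<Union>k. set (C k))"
    proof (intro equalityI subsetI)
      fix v assume "v \<in> (\<Union>k. set (C k))"
      then obtain k where k: "v \<in> set (C k)" by auto
      then have "k \<le> c" using 1(6)[of k] by (cases "k \<le> c") auto
      then show "v \<in> insert r (\<Union>k\<in>{1..c}. set (C k))"
        using k 1(7) by (cases "k = 0") auto
    next
      fix v assume "v \<in> insert r (\<Union>k\<in>{1..c}. set (C k))"
      then show "v \<in> (\<Union>k. set (C k))"
        using 1(7) by (cases "v = r") (auto intro: exI[of _ 0])
    qed
    finally show ?thesis
      by (simp add: uncolored_def)
  qed
  show ?case
  proof (cases "?A = {}")
    case True
    have "bind_pmf ?T (\<lambda>(V, E). branch_loop ?U (i - c) V E (last (C c))) =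
        bind_pmf ?T return_pmf"
      using True A by (intro bind_pmf_cong) (auto simp: branch_loop_covered)
    with True show ?thesis
      using attach_paths_stationary[OF 1(4,6)]
      by (simp add: urn_loop.simps[of n c C] bind_return_pmf bind_return_pmf')
  next
    case False
    then have U: "?U \<noteq> {}" by (auto simp: uncolored_def)
    \<comment> \<open>The continuation after ball \<open>j\<close> is drawn, given the tree so
      far.\<close>
    define K where "K = (\<lambda>j (V, E).
      if j \<in> ?A then branch_loop ?U (i - c) (insert j V) (insert {last (C c), j} E) j
      else case i - c of 0 \<Rightarrow> return_pmf (V, E) | Suc k \<Rightarrow> sprout ?U k V E)"
    have draw: "(if j \<in> ?A then bind_pmf (urn_loop n c (paint j c C)) (\<lambda>C'. attach_paths r C' i)
        else bind_pmf (pmf_of_set ?A) (\<lambda>l.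
          bind_pmf (urn_loop n (Suc c) (paint l (Suc c) C)) (\<lambda>C'. attach_paths r C' i))) =
        bind_pmf ?T (K j)" if j: "j \<in> ?U" for j
    proof (cases "j \<in> ?A")
      case True
      have "bind_pmf (urn_loop n c (paint j c C)) (\<lambda>C'. attach_paths r C' i) =
          bind_pmf (attach_paths r (paint j c C) c)
            (\<lambda>(V, E). branch_loop ?U (i - c) V E (last (paint j c C c)))"
        by (rule "1.IH"(1)) (use False U True j 1 in \<open>auto simp: paint_def\<close>)
      also have "\<dots> = bind_pmf ?T (K j)"
        unfolding attach_paths_paint[of c C r j, OF 1(3,5)] bind_map_pmf
        using True by (intro bind_pmf_cong) (auto simp: K_def paint_def)
      finally show ?thesis using True by simp
    next
      case not_A: False
      show ?thesis
      proof (cases "c = i")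
        case True
        \<comment> \<open>The new color exceeds \<open>i\<close>, so its path is never attached and
          the tree is final.\<close>
        have "bind_pmf (urn_loop n (Suc c) (paint l (Suc c) C)) (\<lambda>C'. attach_paths r C' i) = ?T" for l
        proof -
          have "attach_paths r (paint l (Suc c) C) i = ?T"
            unfolding True by (rule attach_paths_cong) (simp add: paint_def)
          then show ?thesis
            using True by (simp add: urn_loop_attach_paths_less)
        qed
        moreover have "bind_pmf ?T (K j) = bind_pmf ?T return_pmf"
          using not_A True by (intro bind_pmf_cong) (auto simp: K_def)
        ultimately show ?thesis
          using not_A by (simp add: bind_return_pmf')
      next
        case c: False
        then have Suc_c: "Suc c \<le> i" and ic: "i - c = Suc (i - Suc c)"
          using 1(4) by auto
        have "bind_pmf (pmf_of_set ?A) (\<lambda>l.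
            bind_pmf (urn_loop n (Suc c) (paint l (Suc c) C)) (\<lambda>C'. attach_paths r C' i)) =
          bind_pmf (pmf_of_set ?A) (\<lambda>l. bind_pmf (attach_paths r (paint l (Suc c) C) (Suc c))
            (\<lambda>(V, E). branch_loop ?U (i - Suc c) V E (last (paint l (Suc c) C (Suc c)))))"
          by (intro bind_pmf_cong refl "1.IH"(2))
            (use False U not_A j 1 Suc_c in \<open>auto simp: paint_def\<close>)
        also have "\<dots> = bind_pmf (pmf_of_set ?A) (\<lambda>l. bind_pmf ?T (\<lambda>(V, E).
            bind_pmf (pmf_of_set V) (\<lambda>u.
              branch_loop ?U (i - Suc c) (insert l V) (insert {u, l} E) l)))"
          unfolding attach_paths_paint_Suc[of C c, OF 1(6)[OF lessI]]
          by (simp add: bind_assoc_pmf bind_return_pmf case_prod_unfold paint_def 1(6))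
        \<comment> \<open>The draws commute because \<open>?A\<close> does not depend on the random
          tree.\<close>
        also have "\<dots> = bind_pmf ?T (\<lambda>x. bind_pmf (pmf_of_set ?A) (\<lambda>l. case x of (V, E) \<Rightarrow>
            bind_pmf (pmf_of_set V) (\<lambda>u.
              branch_loop ?U (i - Suc c) (insert l V) (insert {u, l} E) l)))"
          by (rule bind_commute_pmf)
        also have "\<dots> = bind_pmf ?T (K j)"
        proof (intro bind_pmf_cong refl)
          fix x assume x: "x \<in> set_pmf ?T"
          obtain V E where VE: "x = (V, E)" by (cases x)
          then have "?U - V = ?A" using A x by simp
          then show "bind_pmf (pmf_of_set ?A) (\<lambda>l. case x of (V, E) \<Rightarrow> bind_pmf (pmf_of_set V)
              (\<lambda>u. branch_loop ?U (i - Suc c) (insert l V) (insert {u, l} E) l)) = K j x"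
            using not_A unfolding VE K_def ic sprout_def
            by (simp, subst bind_commute_pmf) simp
        qed
        finally show ?thesis using not_A by simp
      qed
    qed
    have "bind_pmf (urn_loop n c C) (\<lambda>C'. attach_paths r C' i) =
      bind_pmf (pmf_of_set ?U) (\<lambda>j.
        if j \<in> ?A then bind_pmf (urn_loop n c (paint j c C)) (\<lambda>C'. attach_paths r C' i)
        else bind_pmf (pmf_of_set ?A) (\<lambda>l.
          bind_pmf (urn_loop n (Suc c) (paint l (Suc c) C)) (\<lambda>C'. attach_paths r C' i)))"
      using False
      by (subst urn_loop.simps) (auto simp: bind_assoc_pmf intro!: bind_pmf_cong split: if_splits)
    also have "\<dots> = bind_pmf (pmf_of_set ?U) (\<lambda>j. bind_pmf ?T (K j))"
      using U by (intro bind_pmf_cong refl draw) simp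
    also have "\<dots> = bind_pmf ?T (\<lambda>x. bind_pmf (pmf_of_set ?U) (\<lambda>j. K j x))"
      by (rule bind_commute_pmf)
    also have "\<dots> = bind_pmf ?T (\<lambda>(V, E). branch_loop ?U (i - c) V E (last (C c)))"
    proof (intro bind_pmf_cong refl)
      fix x assume x: "x \<in> set_pmf ?T"
      obtain V E where VE: "x = (V, E)" by (cases x)
      then have "?U - V = ?A" using A x by simp
      then show "bind_pmf (pmf_of_set ?U) (\<lambda>j. K j x) =
          (case x of (V, E) \<Rightarrow> branch_loop ?U (i - c) V E (last (C c)))"
        using False by (simp add: VE K_def branch_loop_rec del: One_nat_def)
    qed
    finally show ?thesis .
  qed
qed

text \<open>The first path can only hang on \<open>r\<close>, so the urn tree is a
  \<open>sprout\<close> from \<open>{r}\<close>. Averaging over the singleton \<open>{r}\<close> is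
  trivial, and \<open>bind_wander\<close> yields the potential of the start state.\<close>

lemma urn_tree_eq_final_tree:
  assumes "n \<ge> 2" "r \<in> {1..n}" "0 < i"
  shows "urn_tree n r i = final_tree {1..n} (start_state i r)"
proof -
  let ?U = "{1..n}"
  define C0 where "C0 = paint r 0 (\<lambda>_. [])"
  have A: "uncolored n C0 = ?U - {r}"
    by (simp add: C0_def uncolored_paint) (simp add: uncolored_def)
  have "card (?U - {r}) \<noteq> 0"
    using assms by simp
  then have ne: "?U - {r} \<noteq> {}" by (metis card.empty)
  have "bind_pmf (urn_loop n 1 (paint j 1 C0)) (\<lambda>C. attach_paths r C i) =
      branch_loop ?U (i - 1) (insert j {r}) (insert {r, j} {}) j" for j
  proof -
    have "attach_paths r (paint j 1 C0) 1 = return_pmf (insert j {r}, insert {r, j} {})"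
      by (simp add: C0_def paint_def path_edges_def bind_return_pmf pmf_of_set_singleton insert_commute)
    moreover have "last (paint j 1 C0 1) = j"
      by (simp add: paint_def)
    ultimately show ?thesis
      using assms(3) by (subst urn_loop_attach_paths) (auto simp: C0_def paint_def bind_return_pmf)
  qed
  then have "urn_tree n r i = sprout ?U (i - 1) {r} {}"
    by (simp add: urn_tree_def urn_coloring_def Let_def bind_assoc_pmf A
        sprout_def pmf_of_set_singleton bind_return_pmf flip: C0_def)
  also have "\<dots> = bind_pmf (pmf_of_set {r}) (wander ?U (i - 1) {r} {})"
    using assms(2) ne by (intro bind_wander[symmetric]) auto
  also have "\<dots> = final_tree ?U (start_state i r)"
    using assms(3) ne
    by (auto simp: pmf_of_set_singleton bind_return_pmf final_tree_def start_state_def stopped_def)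
  finally show ?thesis .
qed

section \<open>The stopping times along a trajectory\<close>

lemma visited_Suc: "visited x (Suc t) = insert (x (Suc t)) (visited x t)"
  by (simp add: visited_def atMost_Suc)

lemma Inf_enat_after:
  "Inf {enat u |u. enat t < enat u \<and> P u} =
    (if P (Suc t) then enat (Suc t) else Inf {enat u |u. enat (Suc t) < enat u \<and> P u})"
proof (cases "P (Suc t)")
  case True
  have "Inf {enat u |u. enat t < enat u \<and> P u} = enat (Suc t)"
    by (intro cInf_eq_minimum) (use True in auto)
  then show ?thesis using True by simp
next
  case False
  then have "{enat u |u. enat t < enat u \<and> P u} = {enat u |u. enat (Suc t) < enat u \<and> P u}"
    by (auto simp: less_Suc_eq) (metis Suc_lessI)
  then show ?thesis using False by simp
qed

text \<open>Before the cover time, \<open>Suc t\<close> is still at most the cover time, so the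
  minimum does not interfere with a hit at \<open>Suc t\<close>.\<close>

lemma next_out_step:
  assumes "enat t < cover_time U x"
  shows "next_out U x (enat t) =
    (if x (Suc t) \<in> visited x t then next_out U x (enat (Suc t)) else enat (Suc t))"
  using assms unfolding next_out_def Inf_enat_after[of t "\<lambda>u. x u \<notin> visited x (u - 1)"]
  by (auto simp: min_def Suc_ile_eq)

lemma next_in_step:
  assumes "enat t < cover_time U x"
  shows "next_in U x (enat t) =
    (if x (Suc t) \<in> visited x t then enat (Suc t) else next_in U x (enat (Suc t)))"
  using assms unfolding next_in_def Inf_enat_after[of t "\<lambda>u. x u \<in> visited x (u - 1)"]
  by (auto simp: min_def Suc_ile_eq)

text \<open>Only later times compete in the infimum, so the minimum is the cover time itself. Being
  a fixed point, it absorbs all remaining excursions.\<close>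

lemma next_out_cover_time: "next_out U x (cover_time U x) = cover_time U x"
  unfolding next_out_def by (intro min_absorb2 Inf_greatest) auto

lemma next_in_cover_time: "next_in U x (cover_time U x) = cover_time U x"
  unfolding next_in_def by (intro min_absorb2 Inf_greatest) auto

text \<open>One departure and return as a single map, so that the number of paths still to be
  started becomes an exponent.\<close>

definition next_excursion :: "'v set \<Rightarrow> (nat \<Rightarrow> 'v) \<Rightarrow> enat \<Rightarrow> enat" where
  "next_excursion U x s = next_in U x (next_out U x s)"

lemma sigma_in_funpow: "sigma_in U x i = (next_excursion U x ^^ i) 0"
  by (induction i) (simp_all add: next_excursion_def)

lemma next_excursion_funpow_cover_time:
  "(next_excursion U x ^^ m) (cover_time U x) = cover_time U x"
  by (induction m) (simp_all add: next_excursion_def next_out_cover_time next_in_cover_time)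

lemma less_cover_time:
  assumes "range x \<subseteq> U" "U - visited x t \<noteq> {}"
  shows "enat t < cover_time U x"
proof (rule ccontr)
  assume "\<not> enat t < cover_time U x"
  then have "cover_time U x \<le> enat t" by simp
  also have "\<dots> < enat (Suc t)" by simp
  finally have "cover_time U x < enat (Suc t)" .
  then obtain u where u: "visited x u = U" "u \<le> t"
    by (auto simp: cover_time_def Inf_less_iff less_Suc_eq_le)
  then have "visited x u \<subseteq> visited x t"
    by (auto simp: visited_def)
  with u assms show False by auto
qed

lemma cover_time_le: "visited x t = U \<Longrightarrow> cover_time U x \<le> enat t"
  unfolding cover_time_def by (intro Inf_lower) auto

lemma fst_AB_tree: "fst (AB_tree x (enat t)) = visited x t"
  by (auto simp: AB_tree_def visited_def)

lemma AB_tree_Suc: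
  assumes "AB_tree x (enat t) = (V, E)"
  shows "AB_tree x (enat (Suc t)) =
    (if x (Suc t) \<in> V then (V, E) else (insert (x (Suc t)) V, insert {x t, x (Suc t)} E))"
proof -
  have V: "V = visited x t" and E: "E = snd (AB_tree x (enat t))"
    using assms fst_AB_tree[of x t] by auto
  have "(\<forall>k\<le>t. x (Suc t) \<noteq> x k) \<longleftrightarrow> x (Suc t) \<notin> V"
    by (auto simp: V visited_def)
  then have "snd (AB_tree x (enat (Suc t))) =
      (if x (Suc t) \<in> V then E else insert {x t, x (Suc t)} E)"
    unfolding E AB_tree_def by (auto simp: less_Suc_eq)
  moreover have "fst (AB_tree x (enat (Suc t))) = insert (x (Suc t)) V"
    unfolding fst_AB_tree V visited_Suc ..
  ultimately show ?thesis
    by (auto intro: prod_eqI)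
qed

section \<open>Following the walk state along a trajectory\<close>

text \<open>Latest step first, to suit \<open>foldr\<close>, and without time 0, so that all entries
  are uniform draws.\<close>

primrec history :: "(nat \<Rightarrow> 'v) \<Rightarrow> nat \<Rightarrow> 'v list" where
  "history x 0 = []"
| "history x (Suc t) = x (Suc t) # history x t"

text \<open>The invariant linking a state to time \<open>t\<close>: the target stopping time is
  obtained by the \<open>m\<close> remaining excursions, applied to \<open>t\<close> itself when
  wandering and to the pending return when inside a path.\<close>

definition tracks :: "'v set \<Rightarrow> (nat \<Rightarrow> 'v) \<Rightarrow> nat \<Rightarrow> 'v walk_state \<Rightarrow> nat \<Rightarrow> bool" where
  "tracks U x i = (\<lambda>(b, m, V, E, p) t.
     sigma_in U x i =
       (next_excursion U x ^^ m) (if b then next_in U x (enat t) else enat t) \<and>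
     AB_tree x (enat t) = (V, E) \<and> p = x t \<and> enat t \<le> cover_time U x)"

lemma tracks_start: "x 0 = r \<Longrightarrow> tracks U x i (start_state i r) 0"
  by (auto simp: tracks_def start_state_def sigma_in_funpow AB_tree_def zero_enat_def[symmetric])

text \<open>When the walk leaves the visited set, the leading excursion \<open>next_in\<close> of
  \<open>next_out\<close> at \<open>t\<close> becomes a pending return from \<open>Suc t\<close>,
  and \<open>m\<close> drops by one. In the other cases the recursions only advance the
  time.\<close>

lemma tracks_step:
  assumes x: "range x \<subseteq> U" and s: "tracks U x i s t" "\<not> stopped U s"
  shows "tracks U x i (walk_step U (x (Suc t)) s) (Suc t)"
proof -
  obtain b m V E p where eq: "s = (b, m, V, E, p)" by (cases s)
  have tree: "AB_tree x (enat t) = (V, E)" and V: "V = visited x t"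
    using s(1) fst_AB_tree[of x t] by (auto simp: eq tracks_def)
  have bm: "U - V \<noteq> {}" "b \<or> 0 < m"
    using s(2) by (auto simp: eq stopped_def)
  have less: "enat t < cover_time U x"
    using less_cover_time[OF x, of t] bm V by simp
  then have le: "enat (Suc t) \<le> cover_time U x"
    by (simp add: Suc_ile_eq)
  have xU: "x (Suc t) \<in> U" using x by auto
  show ?thesis
  proof (cases b)
    case True
    then show ?thesis
      using s xU le AB_tree_Suc[OF tree] V
      by (auto simp: eq tracks_def walk_step_def next_in_step[OF less])
  next
    case False
    then obtain k where "m = Suc k" using bm by (cases m) auto
    then show ?thesis
      using False s xU le AB_tree_Suc[OF tree] V
      by (auto simp: eq tracks_def walk_step_def funpow_swap1 next_excursion_def next_out_step[OF less])
  qed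
qed

text \<open>After covering, \<open>t\<close> is the cover time and is fixed by every remaining
  excursion. Otherwise the exponent is 0 and \<open>t\<close> is the stopping time.\<close>

lemma tracks_stopped:
  assumes x: "range x \<subseteq> U" and s: "tracks U x i s t" "stopped U s"
  shows "AB_tree x (sigma_in U x i) = state_graph s"
proof -
  obtain b m V E p where eq: "s = (b, m, V, E, p)" by (cases s)
  have tree: "AB_tree x (enat t) = (V, E)" and V: "V = visited x t" and
    le: "enat t \<le> cover_time U x"
    using s(1) fst_AB_tree[of x t] by (auto simp: eq tracks_def)
  have "sigma_in U x i = enat t"
  proof (cases "U - V = {}")
    case True
    then have "visited x t = U"
      using x by (auto simp: V visited_def)
    then have "cover_time U x = enat t"
      using cover_time_le le by (metis order_antisym)
    then show ?thesis
      using s(1) next_excursion_funpow_cover_time[of m U x] next_in_cover_time[of U x]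
      by (auto simp: eq tracks_def)
  next
    case False
    then show ?thesis using s by (auto simp: eq tracks_def stopped_def)
  qed
  then show ?thesis
    by (simp add: tree eq state_graph_def)
qed

text \<open>A frozen state keeps describing the time \<open>u\<close> at which it stopped, hence the
  existential.\<close>

lemma tracks_history:
  fixes x i r U
  defines "s t \<equiv> foldr (walk_step U) (history x t) (start_state i r)"
  assumes x: "range x \<subseteq> U" "x 0 = r"
  shows "\<exists>u\<le>t. tracks U x i (s t) u \<and> (stopped U (s t) \<or> u = t)"
proof (induction t)
  case 0
  show ?case using tracks_start[of x, OF x(2)] by (simp add: s_def)
next
  case (Suc t)
  then obtain u where u: "u \<le> t" "tracks U x i (s t) u" "stopped U (s t) \<or> u = t"
    by auto
  have s: "s (Suc t) = walk_step U (x (Suc t)) (s t)"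
    by (simp add: s_def)
  show ?case
  proof (cases "stopped U (s t)")
    case True
    then have "s (Suc t) = s t"
      by (simp add: s walk_step_stopped)
    then show ?thesis using u True by (metis le_SucI)
  next
    case False
    then show ?thesis using u tracks_step[OF x(1), of i "s t" t] unfolding s by auto
  qed
qed

text \<open>Since \<open>history\<close> omits time 0, the hypothesis also asks for a return to
  \<open>r\<close>. It is stronger than covering by time \<open>t\<close>, but is an event of
  uniform draws alone.\<close>

lemma covered_state_graph:
  fixes i :: nat
  assumes x: "range x \<subseteq> U" "x 0 = r" and cov: "U \<subseteq> set (history x t)"
  defines "s \<equiv> foldr (walk_step U) (history x t) (start_state i r)"
  shows "stopped U s" "state_graph s = AB_tree x (sigma_in U x i)"
proof -
  have "set (history x t) \<subseteq> visited x t"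
    by (induction t) (auto simp: visited_Suc)
  with cov have cov: "U \<subseteq> visited x t" by auto
  obtain u where u: "tracks U x i s u" "stopped U s \<or> u = t"
    using tracks_history[OF x, of t i] unfolding s_def by auto
  show "stopped U s"
  proof (cases "u = t")
    case True
    then show ?thesis
      using u(1) cov fst_AB_tree[of x t] by (auto simp: tracks_def stopped_def)
  qed (use u in simp)
  then show "state_graph s = AB_tree x (sigma_in U x i)"
    using tracks_stopped[OF x(1) u(1)] by simp
qed

section \<open>The law of the walk\<close>

lemma pred_count_space:
  "f \<in> M \<rightarrow>\<^sub>M count_space UNIV \<Longrightarrow> Measurable.pred M (\<lambda>\<omega>. P (f \<omega>))"
  by (rule measurable_compose[of f M "count_space UNIV" P]) simp_all

text \<open>\<open>enat\<close> is well-ordered, so the infimum is attained unless it is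
  \<open>\<infinity>\<close>. Each level set is then a countable combination of the given
  events.\<close>

lemma measurable_Inf_enat:
  fixes P :: "'a \<Rightarrow> enat \<Rightarrow> bool"
  assumes [measurable]: "\<And>e. Measurable.pred M (\<lambda>\<omega>. P \<omega> e)"
  shows "(\<lambda>\<omega>. Inf {e. P \<omega> e}) \<in> M \<rightarrow>\<^sub>M count_space UNIV"
proof -
  have "Measurable.pred M (\<lambda>\<omega>. Inf {e. P \<omega> e} = e)" for e
  proof -
    have "Inf {e. P \<omega> e} = e \<longleftrightarrow> (\<forall>d. P \<omega> d \<longrightarrow> e \<le> d) \<and> (P \<omega> e \<or> e = \<infinity>)" for \<omega>
    proof
      assume e: "Inf {e. P \<omega> e} = e"
      have "\<forall>d. P \<omega> d \<longrightarrow> Inf {e. P \<omega> e} \<le> d"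
        by (auto intro: Inf_lower)
      then have "\<forall>d. P \<omega> d \<longrightarrow> e \<le> d"
        by (simp only: e)
      moreover have "P \<omega> e" if "e \<noteq> \<infinity>"
      proof -
        have "{e. P \<omega> e} \<noteq> {}"
          using e that by (metis Inf_empty top_enat_def)
        then show ?thesis
          using e wellorder_InfI[of _ "{e. P \<omega> e}"] by auto
      qed
      ultimately show "(\<forall>d. P \<omega> d \<longrightarrow> e \<le> d) \<and> (P \<omega> e \<or> e = \<infinity>)"
        by auto
    next
      assume "(\<forall>d. P \<omega> d \<longrightarrow> e \<le> d) \<and> (P \<omega> e \<or> e = \<infinity>)"
      then show "Inf {e. P \<omega> e} = e"
        by (intro antisym Inf_greatest) (auto intro: Inf_lower)
    qed
    then show ?thesis by simp
  qed
  then have "{\<omega> \<in> space M. Inf {e. P \<omega> e} = e} \<in> sets M" for e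
    by (rule predE)
  moreover have "(\<lambda>\<omega>. Inf {e. P \<omega> e}) -` {e} \<inter> space M = {\<omega> \<in> space M. Inf {e. P \<omega> e} = e}" for e
    by auto
  ultimately show ?thesis
    by (simp add: measurable_count_space_eq2_countable)
qed

lemma pmf_replicate_Cons:
  "pmf (replicate_pmf (Suc t) p) (y # h) = pmf p y * pmf (replicate_pmf t p) h"
proof -
  have "replicate_pmf (Suc t) p = map_pmf (\<lambda>(x, xs). x # xs) (pair_pmf p (replicate_pmf t p))"
    by (simp add: pair_pmf_def map_bind_pmf bind_assoc_pmf bind_return_pmf)
  moreover have "inj (\<lambda>(x, xs). x # xs)"
    by (auto simp: inj_def)
  ultimately show ?thesis
    using pmf_map_inj'[of "\<lambda>(x, xs). x # xs" "pair_pmf p (replicate_pmf t p)" "(y, h)"]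
    by (simp add: pmf_pair)
qed

lemma prob_replicate_avoid:
  "measure_pmf.prob (replicate_pmf t p) {h. v \<notin> set h} = (1 - pmf p v) ^ t"
proof (induction t)
  case (Suc t)
  let ?q = "replicate_pmf t p"
  have "replicate_pmf (Suc t) p = map_pmf (\<lambda>(x, xs). x # xs) (pair_pmf p ?q)"
    by (simp add: pair_pmf_def map_bind_pmf bind_assoc_pmf bind_return_pmf)
  moreover have "(\<lambda>(x, xs). x # xs) -` {h. v \<notin> set h} = (- {v}) \<times> {h. v \<notin> set h}"
    by auto
  moreover have "measure (pair_pmf p ?q) ((- {v}) \<times> {h. v \<notin> set h}) =
      measure p (- {v}) * measure ?q {h. v \<notin> set h}"
  proof -
    have "ennreal (measure (pair_pmf p ?q) ((- {v}) \<times> {h. v \<notin> set h})) =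
        (\<integral>\<^sup>+z. indicator ((- {v}) \<times> {h. v \<notin> set h}) z \<partial>pair_pmf p ?q)"
      by (simp add: measure_pmf.emeasure_eq_measure)
    also have "\<dots> = (\<integral>\<^sup>+x. \<integral>\<^sup>+h. indicator (- {v}) x * indicator {h. v \<notin> set h} h \<partial>?q \<partial>p)"
      by (simp only: nn_integral_pair_pmf' indicator_times fst_conv snd_conv)
    also have "\<dots> = ennreal (measure p (- {v}) * measure ?q {h. v \<notin> set h})"
      by (simp add: nn_integral_cmult nn_integral_multc measure_pmf.emeasure_eq_measure ennreal_mult'')
    finally show ?thesis by simp
  qed
  moreover have "measure p (- {v}) = 1 - pmf p v"
    using measure_pmf.prob_compl[of "{v}" p] by (simp add: Compl_eq_Diff_UNIV measure_pmf_single)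
  ultimately show ?case
    using Suc by simp
qed simp

lemma history_eq_iff: "history x t = history y t \<longleftrightarrow> (\<forall>k. 0 < k \<and> k \<le> t \<longrightarrow> x k = y k)"
  by (induction t) (auto simp: le_Suc_eq)

lemma length_history [simp]: "length (history x t) = t"
  by (induction t) auto

lemma ex_history: "\<exists>x. x 0 = r \<and> history x (length h) = h"
proof (induction h)
  case (Cons a h)
  then obtain x where x: "x 0 = r" "history x (length h) = h" by blast
  have "history (x(Suc (length h) := a)) (length h) = history x (length h)"
    by (simp add: history_eq_iff)
  with x show ?case
    by (intro exI[of _ "x(Suc (length h) := a)"]) (simp del: fun_upd_apply add: fun_upd_same fun_upd_other)
qed auto

section \<open>The walk on the complete graph: measurability and law\<close>

text \<open>With \<open>'v\<close> countable, lists over it form a countable type, so the law of a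
  history is determined by its point masses.\<close>

locale complete_walk = simple_random_walk M U "complete_graph_with_loops U" r X
  for M :: "'a measure" and U :: "'v :: countable set" and r :: 'v and X +
  assumes finite_U: "finite U" and r_in_U: "r \<in> U"
begin

lemma X_in_U: "\<omega> \<in> space M \<Longrightarrow> X t \<omega> \<in> U"
  using measurable_space[OF walk_measurable] by simp

lemma measurable_X [measurable]: "X t \<in> M \<rightarrow>\<^sub>M count_space UNIV"
  using measurable_compose[OF walk_measurable[of t], of "\<lambda>x. x" "count_space UNIV"] by simp

abbreviation walk :: "'a \<Rightarrow> nat \<Rightarrow> 'v" where
  "walk \<omega> \<equiv> \<lambda>t. X t \<omega>"

lemma measurable_history [measurable]:
  "(\<lambda>\<omega>. history (walk \<omega>) t) \<in> M \<rightarrow>\<^sub>M count_space UNIV"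
proof (induction t)
  case (Suc t)
  note [measurable] = Suc
  have "(\<lambda>\<omega>. X (Suc t) \<omega> # h) \<in> M \<rightarrow>\<^sub>M count_space UNIV" for h
    by (rule measurable_compose[OF measurable_X]) simp
  from measurable_compose_countable[OF this Suc] show ?case by simp
qed simp

lemma pred_eq_X [measurable]: "Measurable.pred M (\<lambda>\<omega>. X s \<omega> = X t \<omega>)"
proof -
  have "Measurable.pred M (\<lambda>\<omega>. \<exists>v. X s \<omega> = v \<and> X t \<omega> = v)"
    by measurable
  then show ?thesis by simp
qed

lemma pred_visited [measurable]: "Measurable.pred M (\<lambda>\<omega>. X s \<omega> \<in> visited (walk \<omega>) t)"
proof -
  have "Measurable.pred M (\<lambda>\<omega>. \<exists>k\<in>{..t}. X s \<omega> = X k \<omega>)"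
    by measurable
  then show ?thesis by (simp add: visited_def image_iff)
qed

lemma measurable_cover_time [measurable]:
  "(\<lambda>\<omega>. cover_time U (walk \<omega>)) \<in> M \<rightarrow>\<^sub>M count_space UNIV"
proof -
  have "Measurable.pred M (\<lambda>\<omega>. visited (walk \<omega>) t = U)" for t
  proof -
    have "Measurable.pred M (\<lambda>\<omega>. \<forall>v. (\<exists>k\<in>{..t}. X k \<omega> = v) \<longleftrightarrow> v \<in> U)"
      by measurable
    moreover have "v \<in> visited (walk \<omega>) t \<longleftrightarrow> (\<exists>k\<in>{..t}. X k \<omega> = v)" for \<omega> v
      by (auto simp: visited_def)
    ultimately show ?thesis by (simp add: set_eq_iff)
  qed
  note [measurable] = this
  show ?thesis
    unfolding cover_time_def by (rule measurable_Inf_enat) measurable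
qed

lemma measurable_next [measurable]:
  assumes [measurable]: "s \<in> M \<rightarrow>\<^sub>M count_space UNIV"
  shows "(\<lambda>\<omega>. next_out U (walk \<omega>) (s \<omega>)) \<in> M \<rightarrow>\<^sub>M count_space UNIV"
    and "(\<lambda>\<omega>. next_in U (walk \<omega>) (s \<omega>)) \<in> M \<rightarrow>\<^sub>M count_space UNIV"
proof -
  have [measurable]: "Measurable.pred M (\<lambda>\<omega>. s \<omega> < e)" for e
    by (rule pred_count_space) measurable
  have min: "(\<lambda>\<omega>. min (a \<omega>) (b \<omega>)) \<in> M \<rightarrow>\<^sub>M count_space UNIV"
    if "a \<in> M \<rightarrow>\<^sub>M count_space UNIV" "b \<in> M \<rightarrow>\<^sub>M count_space UNIV" for a b :: "'a \<Rightarrow> enat"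
    by (rule measurable_compose_countable[where f = "\<lambda>e \<omega>. min e (b \<omega>)", OF _ that(1)])
      (rule measurable_compose[OF that(2)], simp)
  show "(\<lambda>\<omega>. next_out U (walk \<omega>) (s \<omega>)) \<in> M \<rightarrow>\<^sub>M count_space UNIV"
    unfolding next_out_def
    by (intro min measurable_cover_time measurable_Inf_enat) measurable
  show "(\<lambda>\<omega>. next_in U (walk \<omega>) (s \<omega>)) \<in> M \<rightarrow>\<^sub>M count_space UNIV"
    unfolding next_in_def
    by (intro min measurable_cover_time measurable_Inf_enat) measurable
qed

lemma measurable_sigma_in [measurable]:
  "(\<lambda>\<omega>. sigma_in U (walk \<omega>) i) \<in> M \<rightarrow>\<^sub>M count_space UNIV"
  by (induction i) simp_all

text \<open>The tree lies in the finite set \<open>?R\<close>, where equality with a given graph is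
  a finite conjunction of membership events.\<close>

lemma measurable_AB_tree:
  assumes [measurable]: "s \<in> M \<rightarrow>\<^sub>M count_space UNIV"
  shows "(\<lambda>\<omega>. AB_tree (walk \<omega>) (s \<omega>)) \<in> M \<rightarrow>\<^sub>M count_space UNIV"
proof -
  let ?G = "\<lambda>\<omega>. AB_tree (walk \<omega>) (s \<omega>)" and ?R = "Pow U \<times> Pow (Pow U)"
  have [measurable]: "Measurable.pred M (\<lambda>\<omega>. e \<le> s \<omega>)" "Measurable.pred M (\<lambda>\<omega>. e < s \<omega>)" for e
    by (rule pred_count_space, measurable)+
  have R: "?G \<omega> \<in> ?R" if "\<omega> \<in> space M" for \<omega>
    using X_in_U[OF that] by (auto simp: AB_tree_def)
  have V: "Measurable.pred M (\<lambda>\<omega>. v \<in> fst (?G \<omega>))" for v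
    unfolding AB_tree_def by simp
  have E: "Measurable.pred M (\<lambda>\<omega>. e \<in> snd (?G \<omega>))" for e
  proof -
    have "Measurable.pred M (\<lambda>\<omega>. e = {X t \<omega>, X (Suc t) \<omega>})" for t
    proof -
      have "Measurable.pred M (\<lambda>\<omega>. \<exists>u v. X t \<omega> = u \<and> X (Suc t) \<omega> = v \<and> e = {u, v})"
        by measurable
      then show ?thesis by simp
    qed
    note [measurable] = this
    show ?thesis
      unfolding AB_tree_def by simp
  qed
  have "?G -` {g} \<inter> space M \<in> sets M" if g: "g \<in> ?R" for g
  proof -
    have "?G -` {g} \<inter> space M = {\<omega> \<in> space M.
        (\<forall>v\<in>U. v \<in> fst (?G \<omega>) \<longleftrightarrow> v \<in> fst g) \<and> (\<forall>e\<in>Pow U. e \<in> snd (?G \<omega>) \<longleftrightarrow> e \<in> snd g)}"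
      using g R by (fastforce intro!: prod_eqI)
    also have "\<dots> \<in> sets M"
      by (intro predE pred_intros_logic pred_intros_finite V E measurable_const) (auto simp: finite_U)
    finally show ?thesis .
  qed
  then have "?G \<in> M \<rightarrow>\<^sub>M count_space ?R"
    using R finite_U by (simp add: measurable_count_space_eq_countable countable_finite)
  from measurable_compose[OF this, of "\<lambda>x. x" "count_space UNIV"] show ?thesis
    by simp
qed

text \<open>The chain rule: every vertex has all of \<open>U\<close> as neighbors, so each step
  contributes a uniform factor.\<close>

lemma prob_path:
  "prob {\<omega> \<in> space M. \<forall>k\<le>t. X k \<omega> = x k} =
    (if x 0 = r then pmf (replicate_pmf t (pmf_of_set U)) (history x t) else 0)"
proof (induction t)
  case 0
  show ?case
  proof (cases "x 0 = r")
    case True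
    then have "AE \<omega> in M. X 0 \<omega> = x 0"
      using walk_start by simp
    then have "prob {\<omega> \<in> space M. X 0 \<omega> = x 0} = 1"
      by (subst prob_Collect_eq_1) auto
    with True show ?thesis by simp
  next
    case False
    then have "AE \<omega> in M. X 0 \<omega> \<noteq> x 0"
      using walk_start by (elim eventually_mono) simp
    then have "prob {\<omega> \<in> space M. X 0 \<omega> = x 0} = 0"
      by (subst prob_Collect_eq_0) auto
    with False show ?thesis by simp
  qed
next
  case (Suc t)
  let ?B = "{\<omega> \<in> space M. \<forall>k\<le>t. X k \<omega> = x k}"
  let ?A = "{\<omega> \<in> space M. X (Suc t) \<omega> = x (Suc t) \<and> (\<forall>k\<le>t. X k \<omega> = x k)}"
  have U: "U \<noteq> {}" using r_in_U by auto
  have eq: "{\<omega> \<in> space M. \<forall>k\<le>Suc t. X k \<omega> = x k} = ?A"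
    by (auto simp: le_Suc_eq)
  have "prob ?A = pmf (pmf_of_set U) (x (Suc t)) * prob ?B"
  \<comment> \<open>The transition law is given only for pasts of positive probability; for null
    pasts both sides vanish.\<close>
  proof (cases "prob ?B = 0")
    case True
    have "prob ?A \<le> prob ?B"
      by (intro finite_measure_mono) (auto, measurable)
    with True show ?thesis
      using measure_nonneg[of M ?A] by simp
  next
    case False
    then have "?B \<noteq> {}" by (metis measure_empty)
    then obtain \<omega> where "\<omega> \<in> space M" "X t \<omega> = x t" by auto
    then have "x t \<in> U" using X_in_U by metis
    then have "complete_graph_with_loops U `` {x t} = U"
      by (auto simp: complete_graph_with_loops_def)
    moreover have "(x t, x (Suc t)) \<in> complete_graph_with_loops U \<longleftrightarrow> x (Suc t) \<in> U"
      using \<open>x t \<in> U\<close> by (auto simp: complete_graph_with_loops_def)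
    ultimately have "prob ?A / prob ?B = pmf (pmf_of_set U) (x (Suc t))"
      using walk_step[OF False, of "x (Suc t)"] finite_U U
      by (simp add: cond_prob_def indicator_def)
    with False show ?thesis by (simp add: field_simps)
  qed
  then show ?case
    unfolding eq using Suc by (simp add: pmf_replicate_Cons del: replicate_pmf.simps)
qed

lemma distr_history:
  "distr M (count_space UNIV) (\<lambda>\<omega>. history (walk \<omega>) t) = measure_pmf (replicate_pmf t (pmf_of_set U))"
proof (rule measure_eqI_countable[of _ UNIV])
  let ?q = "replicate_pmf t (pmf_of_set U)"
  fix h :: "'v list"
  have "prob {\<omega> \<in> space M. history (walk \<omega>) t = h} = pmf ?q h"
  proof (cases "length h = t")
    case True
    then obtain x where x: "x 0 = r" "history x t = h"
      using ex_history[of r h] by auto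
    have "prob {\<omega> \<in> space M. history (walk \<omega>) t = h} =
        prob {\<omega> \<in> space M. \<forall>k\<le>t. X k \<omega> = x k}"
    \<comment> \<open>The start at \<open>r\<close> holds only almost surely, so the two events
      agree only up to a null set.\<close>
    proof (rule prob_eq_AE)
      show "AE \<omega> in M. history (walk \<omega>) t = h \<longleftrightarrow> (\<forall>k\<le>t. X k \<omega> = x k)"
        using walk_start
      proof eventually_elim
        case (elim \<omega>)
        then show ?case
          unfolding x(2)[symmetric] history_eq_iff using x(1) elim by (metis gr0I)
      qed
    qed measurable
    then show ?thesis using prob_path[of t x] x by simp
  next
    case False
    then have "{\<omega> \<in> space M. history (walk \<omega>) t = h} = {}"
      by auto
    moreover have "h \<notin> set_pmf ?q"
      using False by (simp add: set_replicate_pmf)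
    ultimately show ?thesis
      by (simp only: set_pmf_iff measure_empty not_not)
  qed
  moreover have "(\<lambda>\<omega>. history (walk \<omega>) t) -` {h} \<inter> space M =
      {\<omega> \<in> space M. history (walk \<omega>) t = h}"
    by auto
  ultimately show "emeasure (distr M (count_space UNIV) (\<lambda>\<omega>. history (walk \<omega>) t)) {h} = emeasure ?q {h}"
    by (simp add: emeasure_distr emeasure_eq_measure emeasure_pmf_single)
qed auto

section \<open>Comparison of the two laws and passage to the limit\<close>

text \<open>The expected potential after \<open>t\<close> steps does not depend on \<open>t\<close>.
  Once the history covers \<open>U\<close>, the potential is a point mass at the Aldous-Broder tree,
  so the error is at most the probability of missing some vertex.\<close>

lemma AB_tree_approx:
  fixes A :: "'v graph set" and i :: nat
  defines "G \<equiv> \<lambda>\<omega>. AB_tree (walk \<omega>) (sigma_in U (walk \<omega>) i)"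
  shows "\<bar>measure_pmf.prob (final_tree U (start_state i r)) A - prob (G -` A \<inter> space M)\<bar>
    \<le> real (card U) * (1 - 1 / real (card U)) ^ t"
proof -
  let ?q = "replicate_pmf t (pmf_of_set U)" and ?h = "\<lambda>\<omega>. history (walk \<omega>) t"
  define F where "F h = measure_pmf.prob (final_tree U (foldr (walk_step U) h (start_state i r))) A" for h
  define N where "N = {h. \<not> U \<subseteq> set h}"
  have U: "U \<noteq> {}" using r_in_U by auto
  have [measurable]: "G \<in> M \<rightarrow>\<^sub>M count_space UNIV"
    unfolding G_def by (intro measurable_AB_tree measurable_sigma_in)
  have F01: "0 \<le> F h" "F h \<le> 1" for h
    by (simp_all add: F_def)
  have "measure_pmf.prob (final_tree U (start_state i r)) A =
      measure_pmf.prob (bind_pmf ?q (\<lambda>h. final_tree U (foldr (walk_step U) h (start_state i r)))) A"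
    using finite_U r_in_U
    by (subst bind_replicate_pmf_final_tree) (auto simp: valid_state_def start_state_def)
  also have "\<dots> = measure_pmf.expectation ?q F"
  proof -
    have "emeasure (bind_pmf ?q (\<lambda>h. final_tree U (foldr (walk_step U) h (start_state i r)))) A =
        (\<integral>\<^sup>+h. ennreal (F h) \<partial>?q)"
      by (simp add: F_def flip: measure_pmf.emeasure_eq_measure)
    also have "\<dots> = ennreal (measure_pmf.expectation ?q F)"
      using F01 by (intro nn_integral_eq_integral measure_pmf.integrable_const_bound[of _ 1]) auto
    finally show ?thesis
      using F01 by (simp add: measure_pmf.emeasure_eq_measure integral_nonneg)
  qed
  \<comment> \<open>The abstract uniform draws are replaced by the actual steps of the walk.\<close>
  also have "\<dots> = expectation (\<lambda>\<omega>. F (?h \<omega>))"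
    unfolding distr_history[symmetric] by (rule integral_distr) measurable
  finally have F: "measure_pmf.prob (final_tree U (start_state i r)) A = expectation (\<lambda>\<omega>. F (?h \<omega>))" .
  have meas_F [measurable]: "(\<lambda>\<omega>. F (?h \<omega>)) \<in> borel_measurable M"
    by (rule measurable_compose[OF measurable_history]) simp
  have int_F: "integrable M (\<lambda>\<omega>. F (?h \<omega>))"
    using F01 by (intro integrable_const_bound[of _ 1]) auto
  have GA [measurable]: "G -` A \<inter> space M \<in> sets M" and
    hN [measurable]: "?h -` N \<inter> space M \<in> sets M"
    by (rule measurable_sets[of _ _ "count_space UNIV"], measurable)+
  have "\<bar>expectation (\<lambda>\<omega>. F (?h \<omega>)) - prob (G -` A \<inter> space M)\<bar> =
      \<bar>expectation (\<lambda>\<omega>. F (?h \<omega>) - indicator (G -` A \<inter> space M) \<omega>)\<bar>"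
    using int_F by (subst Bochner_Integration.integral_diff) (auto simp: emeasure_eq_measure)
  also have "\<dots> \<le> expectation (\<lambda>\<omega>. \<bar>F (?h \<omega>) - indicator (G -` A \<inter> space M) \<omega>\<bar>)"
    by (rule integral_abs_bound)
  also have "\<dots> \<le> expectation (indicator (?h -` N \<inter> space M))"
  proof (rule integral_mono_AE)
    show "integrable M (\<lambda>\<omega>. \<bar>F (?h \<omega>) - indicator (G -` A \<inter> space M) \<omega>\<bar>)"
      using int_F by (intro integrable_abs Bochner_Integration.integrable_diff) (auto simp: emeasure_eq_measure)
    show "integrable M (indicator (?h -` N \<inter> space M) :: _ \<Rightarrow> real)"
      by (auto simp: emeasure_eq_measure)
    show "AE \<omega> in M. \<bar>F (?h \<omega>) - indicator (G -` A \<inter> space M) \<omega>\<bar> \<le>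
        indicator (?h -` N \<inter> space M) \<omega>"
      using walk_start AE_space
    proof eventually_elim
      case (elim \<omega>)
      show ?case
      proof (cases "?h \<omega> \<in> N")
        \<comment> \<open>On the exceptional event both quantities lie between 0 and 1.\<close>
        case True
        then show ?thesis
          using elim F01[of "?h \<omega>"] by (auto simp: indicator_def)
      next
        case False
        then have "U \<subseteq> set (?h \<omega>)" by (simp add: N_def)
        moreover have "range (walk \<omega>) \<subseteq> U"
          using elim X_in_U by auto
        ultimately have "final_tree U (foldr (walk_step U) (?h \<omega>) (start_state i r)) = return_pmf (G \<omega>)"
          using covered_state_graph[of "walk \<omega>" U r t i] elim
          by (simp add: final_tree_stopped G_def)
        then show ?thesis
          using elim False by (simp add: F_def indicator_def)
      qed
    qed
  qed
  also have "\<dots> = prob (?h -` N \<inter> space M)"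
    by simp
  also have "\<dots> = measure_pmf.prob ?q N"
    unfolding distr_history[symmetric] by (rule measure_distr[symmetric]) measurable
  \<comment> \<open>Union bound over the missed vertex.\<close>
  also have "\<dots> \<le> (\<Sum>v\<in>U. measure_pmf.prob ?q {h. v \<notin> set h})"
  proof -
    have "N = (\<Union>v\<in>U. {h. v \<notin> set h})"
      by (auto simp: N_def)
    then show ?thesis
      using finite_U measure_pmf.finite_measure_subadditive_finite[of U "\<lambda>v. {h. v \<notin> set h}" ?q]
      by auto
  qed
  also have "\<dots> = real (card U) * (1 - 1 / real (card U)) ^ t"
    using finite_U U by (simp add: prob_replicate_avoid)
  finally show ?thesis
    unfolding F .
qed

lemma distr_AB_tree:
  "distr M (count_space UNIV) (\<lambda>\<omega>. AB_tree (walk \<omega>) (sigma_in U (walk \<omega>) i)) =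
    measure_pmf (final_tree U (start_state i r))"
proof (rule measure_eqI)
  let ?G = "\<lambda>\<omega>. AB_tree (walk \<omega>) (sigma_in U (walk \<omega>) i)"
  have G: "?G \<in> M \<rightarrow>\<^sub>M count_space UNIV"
    by (intro measurable_AB_tree measurable_sigma_in)
  fix A
  let ?d = "\<bar>measure_pmf.prob (final_tree U (start_state i r)) A - prob (?G -` A \<inter> space M)\<bar>"
  have "card U > 0" using finite_U r_in_U by (auto simp: card_gt_0_iff)
  then have "(\<lambda>t. real (card U) * (1 - 1 / real (card U)) ^ t) \<longlonglongrightarrow> real (card U) * 0"
    by (intro tendsto_mult tendsto_const LIMSEQ_realpow_zero) (auto simp: field_simps)
  \<comment> \<open>\<open>?d\<close> does not involve \<open>t\<close>, so the bound passes to the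
    limit.\<close>
  then have "?d \<le> real (card U) * 0"
    by (rule LIMSEQ_le_const) (use AB_tree_approx in blast)
  then show "emeasure (distr M (count_space UNIV) ?G) A = emeasure (final_tree U (start_state i r)) A"
    using G by (simp add: emeasure_distr emeasure_eq_measure measure_pmf.emeasure_eq_measure)
qed simp

end

theorem theorem3:
  fixes n r i :: nat and M :: "'a measure" and X :: "nat \<Rightarrow> 'a \<Rightarrow> nat"
  assumes "n \<ge> 2" and "r \<in> {1..n}"
    and "simple_random_walk M {1..n} (complete_graph_with_loops {1..n}) r X"
    and "i \<in> {1..n - 1}"
  shows "distr M (count_space UNIV)
           (\<lambda>\<omega>. AB_tree (\<lambda>t. X t \<omega>) (sigma_in {1..n} (\<lambda>t. X t \<omega>) i))
         = measure_pmf (urn_tree n r i)"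
proof -
  interpret complete_walk M "{1..n}" r X
    using assms by (intro complete_walk.intro complete_walk_axioms.intro) auto
  show ?thesis
    using assms distr_AB_tree[of i] by (simp add: urn_tree_eq_final_tree)
qed

end
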